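(* For all integers $n,q$ with $2\le q\le n$, \[ k(H(n,q)) \le (n-q)q^{n-1} + k(H(q,q)). \]
   Context: For positive integers $n,q$, let $[q]=\{1,\dots,q\}$. The Hamming graph $H(n,q)$ has vertex set $[q]^n$, two vertices being adjacent iff they differ in exactly one coordinate. The competition graph $C(D)$ of a digraph $D$ is the simple graph on $V(D)$ in which distinct $u,v$ are adjacent iff some vertex $x$ satisfies $(u,x),(v,x)\in A(D)$. The competition number $k(G)$ of a graph $G$ is the least $k\ge0$ such that $G$ together with $k$ new isolated vertices is the competition graph of an acyclic digraph. *)

theory Defs
  imports "Graph_Theory.Pair_Digraph" "HOL-Library.FuncSet"
begin

text \<open>
  Digraphs without parallel arcs are the records \<open>pair_pre_digraph\<close>; following the library, a
  finite simple graph is such a record with a symmetric, irreflexive arc set (\<open>pair_graph\<close>), so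
  an edge \<open>{u, v}\<close> is represented by the two arcs \<open>(u, v)\<close> and \<open>(v, u)\<close>.
\<close>

definition hamming_graph :: "nat \<Rightarrow> nat \<Rightarrow> (nat \<Rightarrow> nat) pair_pre_digraph" where
  "hamming_graph n q =
    \<lparr> pverts = PiE {1..n} (\<lambda>_. {1..q}),
      parcs = {(x, y). x \<in> PiE {1..n} (\<lambda>_. {1..q}) \<and> y \<in> PiE {1..n} (\<lambda>_. {1..q}) \<and>
                       (\<exists>!i. i \<in> {1..n} \<and> x i \<noteq> y i)} \<rparr>"

definition competition_graph :: "'a pair_pre_digraph \<Rightarrow> 'a pair_pre_digraph" where
  "competition_graph D =
    \<lparr> pverts = pverts D,
      parcs = {(u, v). u \<in> pverts D \<and> v \<in> pverts D \<and> u \<noteq> v \<and>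
                       (\<exists>x \<in> pverts D. (u, x) \<in> parcs D \<and> (v, x) \<in> parcs D)} \<rparr>"

text \<open>The disjoint sum of vertex sets guarantees that the \<open>k\<close> added vertices are new.\<close>

definition add_isolated :: "'a pair_pre_digraph \<Rightarrow> nat \<Rightarrow> ('a + nat) pair_pre_digraph" where
  "add_isolated G k =
    \<lparr> pverts = pverts G <+> {..<k},
      parcs = map_prod Inl Inl ` parcs G \<rparr>"

text \<open>
  \<open>LEAST\<close> is meaningful only if some \<open>k\<close> is admissible; the lemma \<open>competition_number_attained\<close>
  below shows that this is the case for every finite simple graph.
\<close>

definition competition_number :: "'a pair_pre_digraph \<Rightarrow> nat" where
  "competition_number G =
    (LEAST k. \<exists>D. pair_digraph D \<and> acyclic (parcs D) \<and> competition_graph D = add_isolated G k)"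

lemma admissible_exists:
  assumes "pair_graph G"
  shows "\<exists>k D. pair_digraph D \<and> acyclic (parcs D) \<and> competition_graph D = add_isolated G k"
proof -
  interpret pair_graph G by fact
  have fin: "finite (parcs G)" "finite (pverts G)"
    using pair_finite_arcs pair_finite_verts by auto
  have symG: "(b, a) \<in> parcs G" if "(a, b) \<in> parcs G" for a b
    using pair_sym_arcs that by (auto simp: symmetric_def sym_def)
  obtain h where h: "bij_betw h (parcs G) {0..<card (parcs G)}"
    using ex_bij_betw_finite_nat[OF fin(1)] by blast
  have inj: "e = e'" if "h e = h e'" "e \<in> parcs G" "e' \<in> parcs G" for e e'
    using h that by (auto simp: bij_betw_def inj_on_def)
  have rng: "h e < card (parcs G)" if "e \<in> parcs G" for e
    using h that by (auto simp: bij_betw_def)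
  define A :: "(('a + nat) \<times> ('a + nat)) set" where
    "A = (\<lambda>e. (Inl (fst e), Inr (h e))) ` parcs G \<union> (\<lambda>e. (Inl (snd e), Inr (h e))) ` parcs G"
  define D where "D = \<lparr> pverts = pverts G <+> {..<card (parcs G)}, parcs = A \<rparr>"
  have AI: "\<exists>u j. a = Inl u \<and> b = Inr j" if "(a, b) \<in> A" for a b
    using that by (auto simp: A_def)
  have "pair_digraph D"
    using fin rng by unfold_locales (auto simp: D_def A_def dest: in_arcsD1 in_arcsD2)
  moreover have "acyclic (parcs D)"
  proof -
    have "trans A" by (rule transI) (use AI in blast)
    then show ?thesis using AI by (fastforce simp: acyclic_def D_def)
  qed
  moreover have "competition_graph D = add_isolated G (card (parcs G))"
  proof -
    have "(u, v) \<in> parcs (competition_graph D) \<longleftrightarrow> (u, v) \<in> map_prod Inl Inl ` parcs G" for u v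
    proof
      assume "(u, v) \<in> parcs (competition_graph D)"
      then obtain x where x: "u \<noteq> v" "(u, x) \<in> A" "(v, x) \<in> A"
        by (auto simp: competition_graph_def D_def)
      obtain e where e: "e \<in> parcs G" "x = Inr (h e)" "u = Inl (fst e) \<or> u = Inl (snd e)"
        using x(2) by (auto simp: A_def)
      obtain e' where e': "e' \<in> parcs G" "x = Inr (h e')" "v = Inl (fst e') \<or> v = Inl (snd e')"
        using x(3) by (auto simp: A_def)
      have "e = e'" using e e' inj by auto
      then show "(u, v) \<in> map_prod Inl Inl ` parcs G"
        using e e' x(1) symG by (cases e) (force simp: map_prod_def)
    next
      assume "(u, v) \<in> map_prod Inl Inl ` parcs G"
      then obtain a b where ab: "(a, b) \<in> parcs G" "u = Inl a" "v = Inl b" by auto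
      have "(u, Inr (h (a, b))) \<in> A" "(v, Inr (h (a, b))) \<in> A" "a \<noteq> b" "a \<in> pverts G" "b \<in> pverts G"
        using ab pair_no_loops[OF ab(1)] in_arcsD1 in_arcsD2 by (force simp: A_def)+
      then show "(u, v) \<in> parcs (competition_graph D)"
        using ab rng[OF ab(1)] by (auto simp: competition_graph_def D_def)
    qed
    then have "parcs (competition_graph D) = map_prod Inl Inl ` parcs G" by (auto simp: set_eq_iff)
    then show ?thesis by (simp add: add_isolated_def competition_graph_def D_def)
  qed
  ultimately show ?thesis by blast
qed

lemma competition_number_attained:
  assumes "pair_graph G"
  obtains D where "pair_digraph D" "acyclic (parcs D)"
    "competition_graph D = add_isolated G (competition_number G)"
  using LeastI_ex[OF admissible_exists[OF assms]] unfolding competition_number_def by blast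

lemma pair_graph_hamming_graph: "pair_graph (hamming_graph n q)"
proof -
  let ?H = "hamming_graph n q"
  have V: "finite (pverts ?H)"
    unfolding hamming_graph_def pair_pre_digraph.simps by (intro finite_PiE) auto
  have sub: "parcs ?H \<subseteq> pverts ?H \<times> pverts ?H"
    by (simp add: hamming_graph_def subset_iff)
  have E: "finite (parcs ?H)"
    using finite_subset[OF sub] V by blast
  have S: "sym (parcs ?H)"
  proof (rule symI)
    fix x y assume a: "(x, y) \<in> parcs ?H"
    have "(\<lambda>i. i \<in> {1..n} \<and> y i \<noteq> x i) = (\<lambda>i. i \<in> {1..n} \<and> x i \<noteq> y i)" by (intro ext) metis
    with a show "(y, x) \<in> parcs ?H" by (simp add: hamming_graph_def)
  qed
  have L: "fst e \<noteq> snd e" if "e \<in> parcs ?H" for e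
  proof -
    have "\<exists>!i. i \<in> {1..n} \<and> fst e i \<noteq> snd e i"
      using that by (simp add: hamming_graph_def case_prod_beta)
    then show ?thesis by (metis ex1_implies_ex)
  qed
  show ?thesis
  proof unfold_locales
    show "fst e \<in> pverts ?H" "snd e \<in> pverts ?H" if "e \<in> parcs ?H" for e
      using sub that by (auto dest!: subsetD)
  qed (use V E S L in \<open>simp_all add: symmetric_def\<close>)
qed

end

(*
  Since two adjacent vertices lie on a unique line and the common preys of a clique can be merged
  into the lowest of them, an acyclic digraph realising H(n,q) amounts to an injection p from lines
  to vertices (old and new) such that p(l) lies strictly below all points of l for some ranking.
  H(q,q) has as many lines as vertices, so p leaves exactly as many old vertices unused as it uses
  new ones. Cut H(n,q) into q^(n-q) parallel copies of H(q,q), stacked one above the other; every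
  copy but the lowest replaces its new vertices by the unused vertices of the copy just below.
  Only the lowest copy and the (n-q) q^(n-1) lines that leave the copies need new vertices.
*)

theory Submission
  imports Defs
begin

section \<open>Points and lines of the Hamming graph\<close>

text \<open>The pair \<open>(i, w)\<close> encodes the line in direction \<open>i\<close> whose other coordinates are given by \<open>w\<close>.\<close>

definition hamming_lines :: "nat \<Rightarrow> nat \<Rightarrow> (nat \<times> (nat \<Rightarrow> nat)) set" where
  "hamming_lines n q = (SIGMA i:{1..n}. PiE ({1..n} - {i}) (\<lambda>_. {1..q}))"

definition line_points :: "nat \<Rightarrow> nat \<times> (nat \<Rightarrow> nat) \<Rightarrow> (nat \<Rightarrow> nat) set" where
  "line_points q l = (\<lambda>a. (snd l)(fst l := a)) ` {1..q}"

text \<open>Here \<open>p l\<close> is meant as the common prey of all points of \<open>l\<close>.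
  The ranking \<open>r\<close> certifies acyclicity; having it as numbers allows the ranks of
  several copies of H(q,q) to be combined arithmetically.\<close>

definition prey_assignment ::
  "nat \<Rightarrow> nat \<Rightarrow> nat \<Rightarrow> (nat \<times> (nat \<Rightarrow> nat) \<Rightarrow> (nat \<Rightarrow> nat) + nat) \<Rightarrow> ((nat \<Rightarrow> nat) + nat \<Rightarrow> nat) \<Rightarrow> bool" where
  "prey_assignment n q k p r \<longleftrightarrow>
    inj_on p (hamming_lines n q) \<and>
    p ` hamming_lines n q \<subseteq> pverts (hamming_graph n q) <+> {..<k} \<and>
    (\<forall>l \<in> hamming_lines n q. \<forall>u \<in> line_points q l. r (p l) < r (Inl u))"

lemma pverts_hamming_graph: "pverts (hamming_graph n q) = PiE {1..n} (\<lambda>_. {1..q})"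
  by (simp add: hamming_graph_def)

lemma finite_pverts_hamming_graph: "finite (pverts (hamming_graph n q))"
  unfolding pverts_hamming_graph by (intro finite_PiE) auto

lemma card_pverts_hamming_graph: "card (pverts (hamming_graph n q)) = q ^ n"
  by (simp add: pverts_hamming_graph card_PiE)

text \<open>The direction set is kept general because two counts are needed: of all lines, and of
  those in the directions above \<open>q\<close>.\<close>

lemma card_lines_in_directions:
  assumes "I \<subseteq> {1..n}"
  shows "card (SIGMA i:I. PiE ({1..n} - {i}) (\<lambda>_. {1..q})) = card I * q ^ (n - 1)"
proof -
  have "finite I" using assms finite_subset by blast
  moreover have "card (PiE ({1..n} - {i}) (\<lambda>_. {1..q})) = q ^ (n - 1)" if "i \<in> I" for i
    using that assms by (subst card_PiE) auto
  ultimately show ?thesis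
    by (subst card_SigmaI) (auto intro!: finite_PiE)
qed

lemma card_hamming_lines: "card (hamming_lines n q) = n * q ^ (n - 1)"
  unfolding hamming_lines_def by (subst card_lines_in_directions) auto

lemma line_points_subset:
  assumes "l \<in> hamming_lines n q"
  shows "line_points q l \<subseteq> pverts (hamming_graph n q)"
proof
  fix u assume "u \<in> line_points q l"
  then obtain a where a: "a \<in> {1..q}" "u = (snd l)(fst l := a)"
    by (auto simp: line_points_def)
  have "fst l \<in> {1..n}" "snd l \<in> PiE ({1..n} - {fst l}) (\<lambda>_. {1..q})"
    using assms by (cases l; simp add: hamming_lines_def)+
  then have "u \<in> PiE (insert (fst l) ({1..n} - {fst l})) (\<lambda>_. {1..q})"
    unfolding a(2) using a(1) by (intro PiE_fun_upd) auto
  then show "u \<in> pverts (hamming_graph n q)"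
    using \<open>fst l \<in> {1..n}\<close> by (simp add: pverts_hamming_graph insert_absorb)
qed

lemma line_points_agree:
  "u \<in> line_points q (i, w) \<Longrightarrow> j \<noteq> i \<Longrightarrow> u j = w j"
  by (auto simp: line_points_def)

lemma line_points_differ:
  "u \<in> line_points q (i, w) \<Longrightarrow> v \<in> line_points q (i, w) \<Longrightarrow> u \<noteq> v \<Longrightarrow> u i \<noteq> v i"
  by (auto simp: line_points_def)

lemma line_points_other:
  assumes "2 \<le> q" "u \<in> line_points q l"
  obtains v where "v \<in> line_points q l" "v \<noteq> u"
proof -
  \<comment> \<open>Both 1 and 2 are admissible coordinates since \<open>2 \<le> q\<close>;
    \<open>a\<close> is one that \<open>u\<close> does not have in the direction of
    \<open>l\<close>.\<close>
  define a where "a = (if u (fst l) = 1 then 2 else 1 :: nat)"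
  have "(snd l)(fst l := a) \<in> line_points q l"
    using assms(1) by (auto simp: line_points_def a_def)
  moreover have "(snd l)(fst l := a) \<noteq> u"
    by (auto simp: a_def dest!: fun_cong[where x = "fst l"])
  ultimately show thesis by (rule that)
qed

lemma parcs_hamming_graph_iff:
  "(u, v) \<in> parcs (hamming_graph n q) \<longleftrightarrow>
    u \<noteq> v \<and> (\<exists>l \<in> hamming_lines n q. u \<in> line_points q l \<and> v \<in> line_points q l)"
proof
  assume "(u, v) \<in> parcs (hamming_graph n q)"
  then have uv: "u \<in> PiE {1..n} (\<lambda>_. {1..q})" "v \<in> PiE {1..n} (\<lambda>_. {1..q})"
    and ex1: "\<exists>!i. i \<in> {1..n} \<and> u i \<noteq> v i"
    by (simp_all add: hamming_graph_def)
  from ex1 obtain i where i: "i \<in> {1..n}" "u i \<noteq> v i"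
    and uniq: "\<And>j. j \<in> {1..n} \<Longrightarrow> u j \<noteq> v j \<Longrightarrow> j = i"
    by (elim ex1E) blast
  \<comment> \<open>The value \<open>undefined\<close> at \<open>i\<close> makes \<open>w\<close>
    extensional on \<open>{1..n} - {i}\<close>, so that every line has a single code.\<close>
  define w where "w = u(i := undefined)"
  have v: "v = w(i := v i)"
  proof
    fix j
    show "v j = (w(i := v i)) j"
    proof (cases "j \<in> {1..n}")
      case True
      then have "j = i \<or> u j = v j" using uniq[of j] by blast
      then show ?thesis by (auto simp: w_def)
    next
      case False
      then have "u j = v j" using uv PiE_arb by metis
      then show ?thesis by (simp add: w_def)
    qed
  qed
  have "w \<in> PiE ({1..n} - {i}) (\<lambda>_. {1..q})"
    unfolding w_def using uv i(1) by (intro fun_upd_in_PiE) (simp_all add: insert_absorb)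
  then have "(i, w) \<in> hamming_lines n q"
    using i by (simp add: hamming_lines_def)
  moreover have "u = w(i := u i)" by (simp add: w_def)
  then have "u \<in> line_points q (i, w)"
    using uv i unfolding line_points_def by (auto simp: PiE_iff intro!: image_eqI[where x = "u i"])
  moreover have "v \<in> line_points q (i, w)"
    using v uv i unfolding line_points_def by (auto simp: PiE_iff intro!: image_eqI[where x = "v i"])
  ultimately show "u \<noteq> v \<and> (\<exists>l \<in> hamming_lines n q. u \<in> line_points q l \<and> v \<in> line_points q l)"
    using i by auto
next
  assume "u \<noteq> v \<and> (\<exists>l \<in> hamming_lines n q. u \<in> line_points q l \<and> v \<in> line_points q l)"
  then obtain i w where ne: "u \<noteq> v" and l: "(i, w) \<in> hamming_lines n q"
    and u: "u \<in> line_points q (i, w)" and v: "v \<in> line_points q (i, w)" by auto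
  have "i \<in> {1..n}" using l by (simp add: hamming_lines_def)
  moreover have "u i \<noteq> v i" using line_points_differ[OF u v ne] .
  moreover have "j = i" if "u j \<noteq> v j" for j
    using that line_points_agree[OF u, of j] line_points_agree[OF v, of j] by metis
  ultimately have "\<exists>!j. j \<in> {1..n} \<and> u j \<noteq> v j" by blast
  then show "(u, v) \<in> parcs (hamming_graph n q)"
    using line_points_subset[OF l] u v unfolding pverts_hamming_graph
    by (simp add: hamming_graph_def subset_iff)
qed

text \<open>A clique of the Hamming graph lies on one line. The hypothesis \<open>clique\<close>
  says that points of the two pairs differ pairwise in at most one coordinate; this form also covers
  points that coincide.\<close>

lemma line_unique:
  assumes l: "(i, w) \<in> hamming_lines n q" "(i', w') \<in> hamming_lines n q"
    and u: "u \<in> line_points q (i, w)" "v \<in> line_points q (i, w)" "u \<noteq> v"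
    and u': "u' \<in> line_points q (i', w')" "v' \<in> line_points q (i', w')" "u' \<noteq> v'"
    and clique: "\<And>x y j k. x \<in> {u, v} \<Longrightarrow> y \<in> {u', v'} \<Longrightarrow> x j \<noteq> y j \<Longrightarrow> x k \<noteq> y k \<Longrightarrow> j = k"
  shows "(i, w) = (i', w')"
proof -
  have d: "u i \<noteq> v i" "u' i' \<noteq> v' i'"
    using line_points_differ u u' by blast+
  note agree = line_points_agree[OF u(1)] line_points_agree[OF u(2)]
    line_points_agree[OF u'(1)] line_points_agree[OF u'(2)]
  have ii: "i = i'"
  proof (rule ccontr)
    assume ne: "i \<noteq> i'"
    then have "u' i = v' i" using agree by metis
    \<comment> \<open>The points \<open>u'\<close> and \<open>v'\<close> share their coordinate
      \<open>i\<close> while \<open>u\<close> and \<open>v\<close> do not, so one of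
      \<open>u\<close>, \<open>v\<close> misses the shared value. It must then agree at
      \<open>i'\<close> with both \<open>u'\<close> and \<open>v'\<close>, which differ
      there.\<close>
    then obtain x where x: "x \<in> {u, v}" "x i \<noteq> u' i" "x i \<noteq> v' i"
      using d by (metis insertI1 insertI2)
    then have "x i' = u' i'" "x i' = v' i'"
      using clique[OF x(1), of u' i i'] clique[OF x(1), of v' i i'] ne by auto
    then show False using d by simp
  qed
  have "w j = w' j" for j
  proof (cases "j = i")
    case True
    then show ?thesis using l ii by (auto simp: hamming_lines_def PiE_iff extensional_def)
  next
    case False
    show ?thesis
    proof (rule ccontr)
      assume "w j \<noteq> w' j"
      \<comment> \<open>With equal directions, a difference off \<open>i\<close> separates both
        \<open>u\<close> and \<open>v\<close> from \<open>u'\<close>, which uses up the one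
        coordinate allowed and forces \<open>u i = v i\<close>.\<close>
      then have "u j \<noteq> u' j" "v j \<noteq> u' j" using agree False ii by auto
      then have "u i = u' i" "v i = u' i"
        using clique[of u u' j i] clique[of v u' j i] False by auto
      then show False using d by simp
    qed
  qed
  then show ?thesis using ii by auto
qed

section \<open>Acyclic digraphs and prey assignments\<close>

text \<open>The rank of a vertex counts what it reaches by nonempty paths. Along an arc from
  \<open>x\<close> to \<open>y\<close> this set shrinks properly: \<open>x\<close> reaches
  \<open>y\<close>, but \<open>y\<close> does not reach itself.\<close>

lemma acyclic_rank:
  assumes "finite A" "acyclic A"
  obtains r :: "'a \<Rightarrow> nat" where "\<And>x y. (x, y) \<in> A \<Longrightarrow> r y < r x"
proof
  fix x y assume xy: "(x, y) \<in> A"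
  have "A\<^sup>+ `` {y} \<subseteq> A\<^sup>+ `` {x}"
    using xy by (auto intro: trancl_into_trancl2)
  moreover have "y \<in> A\<^sup>+ `` {x}" "y \<notin> A\<^sup>+ `` {y}"
    using xy assms(2) by (auto simp: acyclic_def)
  ultimately have "A\<^sup>+ `` {y} \<subset> A\<^sup>+ `` {x}" by blast
  moreover have "finite (A\<^sup>+ `` {x})"
    using assms(1) by (simp add: finite_Image)
  ultimately show "card (A\<^sup>+ `` {y}) < card (A\<^sup>+ `` {x})"
    by (rule psubset_card_mono[rotated])
qed

lemma competition_graph_arcs_iff:
  assumes "competition_graph D = add_isolated G k"
  shows "(Inl u, Inl v) \<in> parcs (competition_graph D) \<longleftrightarrow> (u, v) \<in> parcs G"
  using assms by (force simp: add_isolated_def)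

text \<open>Each line receives the lowest vertex that is a common prey of two of its points. If two
  lines receive the same vertex, the two pairs of points preying on it form a clique, so the lines
  coincide.\<close>

lemma prey_assignment_of_digraph:
  assumes q: "2 \<le> q" and D: "pair_digraph D" "acyclic (parcs D)"
    and comp: "competition_graph D = add_isolated (hamming_graph n q) k"
  obtains p r where "prey_assignment n q k p r"
proof -
  interpret pair_digraph D by fact
  have V: "pverts D = pverts (hamming_graph n q) <+> {..<k}"
    using arg_cong[OF comp, of pverts] by (simp add: competition_graph_def add_isolated_def)
  obtain r :: "(nat \<Rightarrow> nat) + nat \<Rightarrow> nat" where r: "\<And>x y. (x, y) \<in> parcs D \<Longrightarrow> r y < r x"
    using acyclic_rank[OF pair_finite_arcs D(2)] by blast
  define prey where "prey l x \<longleftrightarrow> x \<in> pverts D \<and> (\<exists>u v. u \<in> line_points q l \<and> v \<in> line_points q l \<and>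
    u \<noteq> v \<and> (Inl u, x) \<in> parcs D \<and> (Inl v, x) \<in> parcs D)" for l x
  define p where "p l = arg_min r (prey l)" for l
  have share: "\<exists>x. prey l x \<and> (Inl u, x) \<in> parcs D"
    if l: "l \<in> hamming_lines n q" and u: "u \<in> line_points q l" for l u
  proof -
    obtain v where v: "v \<in> line_points q l" "v \<noteq> u" using line_points_other[OF q u] .
    have "(u, v) \<in> parcs (hamming_graph n q)"
      using l u v by (auto simp: parcs_hamming_graph_iff)
    then have "(Inl u, Inl v) \<in> parcs (competition_graph D)"
      using competition_graph_arcs_iff[OF comp] by blast
    then show ?thesis
      using u v by (auto simp: competition_graph_def prey_def)
  qed
  have p: "prey l (p l)" if l: "l \<in> hamming_lines n q" for l
  proof -
    have "(snd l)(fst l := 1) \<in> line_points q l" using q by (auto simp: line_points_def)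
    then obtain x where "prey l x" using share[OF l] by blast
    then show ?thesis unfolding p_def by (rule arg_min_natI)
  qed
  \<comment> \<open>Vertices with a common prey are equal or adjacent, hence differ in at most one
    coordinate; this is the clique hypothesis of \<open>line_unique\<close>.\<close>
  have adj: "j = k'" if "(Inl x, z) \<in> parcs D" "(Inl y, z) \<in> parcs D" "x j \<noteq> y j" "x k' \<noteq> y k'"
    for x y :: "nat \<Rightarrow> nat" and z j k'
  proof -
    have "(Inl x, Inl y) \<in> parcs (competition_graph D)"
      using that in_arcsD1 in_arcsD2 by (auto simp: competition_graph_def)
    then have "(x, y) \<in> parcs (hamming_graph n q)"
      using competition_graph_arcs_iff[OF comp] by blast
    then obtain i w where "x \<in> line_points q (i, w)" "y \<in> line_points q (i, w)"
      by (auto simp: parcs_hamming_graph_iff)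
    then show ?thesis using that(3,4) line_points_agree by metis
  qed
  have "prey_assignment n q k p r"
    unfolding prey_assignment_def
  proof (intro conjI ballI)
    show "p ` hamming_lines n q \<subseteq> pverts (hamming_graph n q) <+> {..<k}"
      using p unfolding V[symmetric] prey_def by auto
    \<comment> \<open>The point \<open>u\<close> need not prey on \<open>p l\<close> itself. It
      shares some prey \<open>x\<close> with another point of \<open>l\<close>; \<open>x\<close> is
      below \<open>u\<close>, and \<open>p l\<close> is no higher than \<open>x\<close> by
      minimality.\<close>
    show "r (p l) < r (Inl u)" if l: "l \<in> hamming_lines n q" "u \<in> line_points q l" for l u
    proof -
      obtain x where x: "prey l x" "(Inl u, x) \<in> parcs D" using share[OF l] by blast
      then show ?thesis using r[OF x(2)] arg_min_nat_le[of "prey l" x r] by (simp add: p_def)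
    qed
    show "inj_on p (hamming_lines n q)"
    proof (rule inj_onI)
      fix l l' assume l: "l \<in> hamming_lines n q" "l' \<in> hamming_lines n q" and eq: "p l = p l'"
      obtain i w i' w' where iw: "l = (i, w)" "l' = (i', w')" by fastforce
      obtain u v where uv: "u \<in> line_points q l" "v \<in> line_points q l" "u \<noteq> v"
        "(Inl u, p l) \<in> parcs D" "(Inl v, p l) \<in> parcs D"
        using p[OF l(1)] by (auto simp: prey_def)
      obtain u' v' where uv': "u' \<in> line_points q l'" "v' \<in> line_points q l'" "u' \<noteq> v'"
        "(Inl u', p l) \<in> parcs D" "(Inl v', p l) \<in> parcs D"
        using p[OF l(2)] eq by (auto simp: prey_def)
      show "l = l'"
        unfolding iw
      proof (rule line_unique)
        show "j = k'" if "x \<in> {u, v}" "y \<in> {u', v'}" "x j \<noteq> y j" "x k' \<noteq> y k'" for x y j k'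
          using that uv uv' by (intro adj[of x "p l" y j k']) auto
      qed (use l uv uv' iw in auto)
    qed
  qed
  then show thesis by (rule that)
qed

text \<open>Draw an arc from every point of each line \<open>l\<close> to \<open>p l\<close>. As
  \<open>p\<close> is injective, two vertices compete only if they lie on a common line. The ranking
  decreases along arcs, and the new vertices have no outgoing arcs, so they stay isolated.\<close>

lemma competition_number_le_of_prey_assignment:
  assumes "prey_assignment n q k p r"
  shows "competition_number (hamming_graph n q) \<le> k"
proof -
  let ?L = "hamming_lines n q" and ?V = "pverts (hamming_graph n q) <+> {..<k}"
  have inj: "inj_on p ?L" and rng: "p ` ?L \<subseteq> ?V"
    and r: "\<And>l u. l \<in> ?L \<Longrightarrow> u \<in> line_points q l \<Longrightarrow> r (p l) < r (Inl u)"
    using assms by (auto simp: prey_assignment_def)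
  define A :: "(((nat \<Rightarrow> nat) + nat) \<times> ((nat \<Rightarrow> nat) + nat)) set"
    where "A = (\<Union>l \<in> ?L. (\<lambda>u. (Inl u, p l)) ` line_points q l)"
  define D where "D = \<lparr> pverts = ?V, parcs = A \<rparr>"
  have finV: "finite ?V" by (simp add: finite_pverts_hamming_graph)
  have AV: "A \<subseteq> ?V \<times> ?V"
    using rng line_points_subset unfolding A_def by blast
  have Ar: "r y < r x" if "(x, y) \<in> A" for x y
    using that r by (auto simp: A_def)
  have finA: "finite A" using finite_subset[OF AV] finV by blast
  have "pair_digraph D"
    using finV finA AV Ar by unfold_locales (auto simp: D_def dest: Ar)
  moreover have "acyclic (parcs D)"
  proof (rule acyclic_subset)
    show "acyclic ((measure r)\<inverse>)" by (simp add: wf_acyclic)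
    show "parcs D \<subseteq> (measure r)\<inverse>" using Ar by (auto simp: D_def)
  qed
  moreover have "competition_graph D = add_isolated (hamming_graph n q) k"
  proof -
    have "(x, y) \<in> parcs (competition_graph D) \<longleftrightarrow> (x, y) \<in> map_prod Inl Inl ` parcs (hamming_graph n q)"
      for x y
    proof
      assume "(x, y) \<in> parcs (competition_graph D)"
      then obtain z where z: "x \<noteq> y" "(x, z) \<in> A" "(y, z) \<in> A"
        by (auto simp: competition_graph_def D_def)
      obtain l u where l: "l \<in> ?L" "u \<in> line_points q l" "x = Inl u" "z = p l"
        using z(2) by (auto simp: A_def)
      moreover obtain l' v where l': "l' \<in> ?L" "v \<in> line_points q l'" "y = Inl v" "z = p l'"
        using z(3) by (auto simp: A_def)
      ultimately have "l = l'" using inj by (metis inj_onD)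
      then have "(u, v) \<in> parcs (hamming_graph n q)"
        using l l' z(1) by (auto simp: parcs_hamming_graph_iff)
      then show "(x, y) \<in> map_prod Inl Inl ` parcs (hamming_graph n q)"
        using l l' by force
    next
      assume "(x, y) \<in> map_prod Inl Inl ` parcs (hamming_graph n q)"
      then obtain u v l where xy: "x = Inl u" "y = Inl v" "u \<noteq> v"
        and l: "l \<in> ?L" "u \<in> line_points q l" "v \<in> line_points q l"
        by (auto simp: parcs_hamming_graph_iff)
      then have "(x, p l) \<in> A" "(y, p l) \<in> A" by (auto simp: A_def)
      then show "(x, y) \<in> parcs (competition_graph D)"
        using AV xy unfolding competition_graph_def D_def by auto
    qed
    then have "parcs (competition_graph D) = map_prod Inl Inl ` parcs (hamming_graph n q)"
      by (auto simp: set_eq_iff)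
    then show ?thesis by (simp add: add_isolated_def competition_graph_def D_def)
  qed
  ultimately show ?thesis
    unfolding competition_number_def by (intro Least_le) blast
qed

section \<open>Stacking copies of H(q,q)\<close>

text \<open>The \<open>q * q ^ (q - 1)\<close> lines take distinct values, and there are at least as
  many old vertices as lines. So the new vertices taken are at most as many as the old ones left
  free, and \<open>s\<close> matches them injectively.\<close>

lemma unused_vertices:
  assumes "prey_assignment q q c p r"
  obtains s where "inj_on s {j. Inr j \<in> p ` hamming_lines q q}"
    "\<And>j. Inr j \<in> p ` hamming_lines q q \<Longrightarrow>
      s j \<in> pverts (hamming_graph q q) \<and> Inl (s j) \<notin> p ` hamming_lines q q"
proof -
  let ?V = "pverts (hamming_graph q q)" and ?P = "p ` hamming_lines q q"
  let ?J = "{j. Inr j \<in> ?P}" and ?W = "{v. Inl v \<in> ?P}"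
  have P: "?P = ?W <+> ?J"
  proof (rule set_eqI)
    show "x \<in> ?P \<longleftrightarrow> x \<in> ?W <+> ?J" for x by (cases x) auto
  qed
  have sub: "?P \<subseteq> ?V <+> {..<c}" and inj: "inj_on p (hamming_lines q q)"
    using assms by (auto simp: prey_assignment_def)
  have WV: "?W \<subseteq> ?V" and J: "?J \<subseteq> {..<c}"
    using sub by auto
  have finJ: "finite ?J" and finW: "finite ?W"
    using finite_subset[OF J] finite_subset[OF WV finite_pverts_hamming_graph] by auto
  have "card ?W + card ?J = card ?P"
    by (subst P) (simp only: card_Plus[OF finW finJ])
  also have "\<dots> = q * q ^ (q - 1)"
    using card_image[OF inj] card_hamming_lines by simp
  \<comment> \<open>Equality holds for positive \<open>q\<close>; for \<open>q = 0\<close> the sides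
    are 0 and 1.\<close>
  also have "\<dots> \<le> q ^ q" by (cases q) auto
  also have "\<dots> = card ?V" by (simp add: card_pverts_hamming_graph)
  finally have "card ?J \<le> card (?V - ?W)"
    using card_Diff_subset[OF finW WV] by linarith
  then obtain s where "s ` ?J \<subseteq> ?V - ?W" "inj_on s ?J"
    using card_le_inj[OF finJ, of "?V - ?W"] finite_pverts_hamming_graph by blast
  then show thesis by (intro that[of s]) blast+
qed

text \<open>A vertex of a copy can be claimed by a line of that copy through \<open>p\<close>, or by
  a line of the copy just above through \<open>s\<close>. The range of \<open>s\<close> avoids that
  of \<open>p\<close>, so no vertex is claimed twice.\<close>

lemma prey_assignment_lift:
  assumes qn: "q \<le> n" and pr: "prey_assignment q q c p r"
  obtains P R where "prey_assignment n q ((n - q) * q ^ (n - 1) + c) P R"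
proof -
  let ?Lq = "hamming_lines q q" and ?Vq = "pverts (hamming_graph q q)"
  let ?L = "hamming_lines n q" and ?V = "pverts (hamming_graph n q)"
  let ?M = "(n - q) * q ^ (n - 1)"
  \<comment> \<open>The coordinates above \<open>q\<close> name the copy, so \<open>T\<close>
    indexes the copies; \<open>X\<close> collects the lines that leave them. Below, \<open>e\<close>
    gives the height of a copy, with 0 the lowest, and \<open>g\<close> finds the copy at a given
    height.\<close>
  define T where "T = PiE {q+1..n} (\<lambda>_. {1..q})"
  define X where "X = (SIGMA i:{q+1..n}. PiE ({1..n} - {i}) (\<lambda>_. {1..q}))"
  have inj: "inj_on p ?Lq" and rng: "p ` ?Lq \<subseteq> ?Vq <+> {..<c}"
    and r: "\<And>l u. l \<in> ?Lq \<Longrightarrow> u \<in> line_points q l \<Longrightarrow> r (p l) < r (Inl u)"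
    using pr by (auto simp: prey_assignment_def)
  obtain s where s_inj: "inj_on s {j. Inr j \<in> p ` ?Lq}"
    and s: "\<And>j. Inr j \<in> p ` ?Lq \<Longrightarrow> s j \<in> ?Vq \<and> Inl (s j) \<notin> p ` ?Lq"
    using unused_vertices[OF pr] by blast
  have "finite T" unfolding T_def by (intro finite_PiE) auto
  then obtain e where e: "bij_betw e T {0..<card T}"
    using ex_bij_betw_finite_nat by blast
  define g where "g = inv_into T e"
  have e_inj: "t = t'" if "e t = e t'" "t \<in> T" "t' \<in> T" for t t'
    using e that by (auto simp: bij_betw_def inj_on_def)
  \<comment> \<open>For the lowest copy truncated subtraction gives height 0 again, so no case
    distinction is needed here.\<close>
  have under: "g (e t - 1) \<in> T" "e (g (e t - 1)) = e t - 1" if "t \<in> T" for t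
  proof -
    have "e t < card T" using e that by (auto simp: bij_betw_def)
    then have "e t - 1 \<in> e ` T" using e by (auto simp: bij_betw_def)
    then show "g (e t - 1) \<in> T" "e (g (e t - 1)) = e t - 1"
      by (auto simp: g_def inv_into_into f_inv_into_f)
  qed
  have "finite X" unfolding X_def by (intro finite_SigmaI finite_PiE) auto
  moreover have "card X = ?M"
    unfolding X_def by (subst card_lines_in_directions) auto
  ultimately obtain h where h: "bij_betw h X {0..<?M}"
    using ex_bij_betw_finite_nat by metis
  \<comment> \<open>\<open>B\<close> exceeds all ranks of old vertices of H(q,q), so it can serve as
    the height of one layer of ranks in \<open>R\<close>.\<close>
  define B where "B = Suc (Max ((\<lambda>v. r (Inl v)) ` ?Vq))"
  have B: "r (Inl v) < B" if "v \<in> ?Vq" for v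
    using that finite_pverts_hamming_graph by (auto simp: B_def less_Suc_eq_le)
  define join :: "(nat \<Rightarrow> nat) \<Rightarrow> (nat \<Rightarrow> nat) \<Rightarrow> nat \<Rightarrow> nat"
    where "join v t = (\<lambda>i. if i \<le> q then v i else t i)" for v t
  define lo hi :: "(nat \<Rightarrow> nat) \<Rightarrow> nat \<Rightarrow> nat"
    where "lo w = restrict w {1..q}" and "hi w = restrict w {q+1..n}" for w
  have join: "join v t \<in> ?V" "lo (join v t) = v" "hi (join v t) = t" if "v \<in> ?Vq" "t \<in> T" for v t
    using that qn by (auto simp: join_def lo_def hi_def T_def pverts_hamming_graph PiE_iff
        extensional_def fun_eq_iff restrict_def)
  \<comment> \<open>A line in a direction up to \<open>q\<close> is the line
    \<open>(i, lo w)\<close> of the copy \<open>hi w\<close>. New labels below \<open>c\<close> go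
    to the lowest copy only, those from \<open>c\<close> on to the lines in
    \<open>X\<close>.\<close>
  define P where "P l = (if fst l \<le> q then
      (case p (fst l, lo (snd l)) of
        Inl v \<Rightarrow> Inl (join v (hi (snd l)))
      | Inr j \<Rightarrow> if e (hi (snd l)) = 0 then Inr j else Inl (join (s j) (g (e (hi (snd l)) - 1))))
      else Inr (c + h l))" for l
  \<comment> \<open>The \<open>Suc\<close> puts every old vertex above all new ones, which have rank
    0.\<close>
  define R :: "(nat \<Rightarrow> nat) + nat \<Rightarrow> nat" where
    "R x = (case x of Inl u \<Rightarrow> Suc (e (hi u) * B + r (Inl (lo u))) | Inr j \<Rightarrow> 0)" for x
  have low: "(i, lo w) \<in> ?Lq" "hi w \<in> T" if "(i, w) \<in> ?L" "i \<le> q" for i w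
    using that qn by (auto simp: hamming_lines_def lo_def hi_def T_def PiE_iff extensional_def)
  have high: "(i, w) \<in> X" if "(i, w) \<in> ?L" "\<not> i \<le> q" for i w
    using that by (auto simp: hamming_lines_def X_def)
  have hX: "h l < ?M" if "l \<in> X" for l
    using h that by (auto simp: bij_betw_def)
  have P_cases [consumes 1, case_names old new below out]: thesis
    if l: "(i, w) \<in> ?L"
      and "\<And>v. i \<le> q \<Longrightarrow> (i, lo w) \<in> ?Lq \<Longrightarrow> hi w \<in> T \<Longrightarrow> p (i, lo w) = Inl v \<Longrightarrow> v \<in> ?Vq \<Longrightarrow>
        P (i, w) = Inl (join v (hi w)) \<Longrightarrow> thesis"
      and "\<And>j. i \<le> q \<Longrightarrow> (i, lo w) \<in> ?Lq \<Longrightarrow> hi w \<in> T \<Longrightarrow> p (i, lo w) = Inr j \<Longrightarrow> j < c \<Longrightarrow>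
        e (hi w) = 0 \<Longrightarrow> P (i, w) = Inr j \<Longrightarrow> thesis"
      and "\<And>j. i \<le> q \<Longrightarrow> (i, lo w) \<in> ?Lq \<Longrightarrow> hi w \<in> T \<Longrightarrow> p (i, lo w) = Inr j \<Longrightarrow> j < c \<Longrightarrow>
        e (hi w) > 0 \<Longrightarrow> s j \<in> ?Vq \<Longrightarrow> Inl (s j) \<notin> p ` ?Lq \<Longrightarrow>
        P (i, w) = Inl (join (s j) (g (e (hi w) - 1))) \<Longrightarrow> thesis"
      and "(i, w) \<in> X \<Longrightarrow> \<not> i \<le> q \<Longrightarrow> P (i, w) = Inr (c + h (i, w)) \<Longrightarrow> thesis"
    for i w thesis
  proof (cases "i \<le> q")
    case True
    note lw = low[OF l True]
    show thesis
    proof (cases "p (i, lo w)")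
      case (Inl v)
      have "Inl v \<in> ?Vq <+> {..<c}" using rng lw(1) Inl by (metis image_subset_iff)
      then show thesis using that(2)[OF True lw Inl] Inl True by (auto simp: P_def)
    next
      case (Inr j)
      have j: "Inr j \<in> p ` ?Lq" using lw(1) Inr by (metis imageI)
      then have "Inr j \<in> ?Vq <+> {..<c}" using rng by blast
      then show thesis
        using that(3)[OF True lw Inr] that(4)[OF True lw Inr] s[OF j] Inr True
        by (cases "e (hi w) = 0") (auto simp: P_def)
    qed
  next
    case False
    then show thesis using that(5) high[OF l] by (auto simp: P_def)
  qed
  have "prey_assignment n q (?M + c) P R"
    unfolding prey_assignment_def
  proof (intro conjI ballI)
    show "P ` ?L \<subseteq> ?V <+> {..<?M + c}"
    proof (rule image_subsetI)
      fix l assume "l \<in> ?L"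
      then obtain i w where l: "l = (i, w)" "(i, w) \<in> ?L" by (cases l) auto
      from l(2) have "P (i, w) \<in> ?V <+> {..<?M + c}"
        by (cases i w rule: P_cases) (auto simp: join under simp del: One_nat_def dest: hX)
      then show "P l \<in> ?V <+> {..<?M + c}" using l by simp
    qed
  next
    fix l u assume "l \<in> ?L" and u': "u \<in> line_points q l"
    then obtain i w where l: "l = (i, w)" "(i, w) \<in> ?L" and u: "u \<in> line_points q (i, w)"
      by (cases l) auto
    have lo_u: "lo u \<in> line_points q (i, lo w)" and hi_u: "hi u = hi w" if "i \<le> q"
    proof -
      have "i \<in> {1..q}" using l(2) that by (auto simp: hamming_lines_def)
      then have "lo (w(i := a)) = (lo w)(i := a)" "hi (w(i := a)) = hi w" for a
        by (auto simp: lo_def hi_def fun_eq_iff restrict_def)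
      then show "lo u \<in> line_points q (i, lo w)" "hi u = hi w"
        using u by (auto simp: line_points_def)
    qed
    from l(2) have "R (P (i, w)) < R (Inl u)"
    proof (cases i w rule: P_cases)
      case (old v)
      then show ?thesis
        using r[OF old(2) lo_u] hi_u by (simp add: R_def join)
    next
      case (below j)
      then obtain d where d: "e (hi w) = Suc d" using gr0_implies_Suc by blast
      \<comment> \<open>The prey lies in layer \<open>d\<close>, so its rank is less than
        \<open>Suc (Suc d * B)\<close>, while \<open>u\<close> lies in layer
        \<open>Suc d\<close>.\<close>
      show ?thesis
        using below hi_u B[of "s j"] join[of "s j" "g (e (hi w) - 1)"] under[of "hi w"]
        by (simp add: R_def d)
    qed (simp_all add: R_def)
    then show "R (P l) < R (Inl u)" using l by simp
  next
    show "inj_on P ?L"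
    proof (rule inj_onI)
      fix l l' assume "l \<in> ?L" "l' \<in> ?L" and "P l = P l'"
      then obtain i w i' w' where l: "l = (i, w)" "(i, w) \<in> ?L" "l' = (i', w')" "(i', w') \<in> ?L"
        and eq: "P (i, w) = P (i', w')" by (cases l; cases l') auto
      have join_inj: "v = v' \<and> t = t'"
        if "join v t = join v' t'" "v \<in> ?Vq" "t \<in> T" "v' \<in> ?Vq" "t' \<in> T" for v t v' t'
        using that join by metis
      \<comment> \<open>Equal values of \<open>p\<close> give the same direction and the same
        coordinates up to \<open>q\<close>; equal copies give the rest.\<close>
      have fin: "(i, w) = (i', w')"
        if "i \<le> q" "i' \<le> q" "p (i, lo w) = p (i', lo w')" "hi w = hi w'"
      proof -
        have ii: "i = i'" and lo: "lo w = lo w'"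
          using inj_onD[OF inj that(3)] low that l by auto
        have "w k = w' k" for k
        proof -
          consider "k \<in> {1..q}" | "k \<in> {q+1..n}" | "k \<notin> {1..n}" by fastforce
          then show ?thesis
          proof cases
            case 1
            then show ?thesis using fun_cong[OF lo, of k] by (simp add: lo_def)
          next
            case 2
            then show ?thesis using fun_cong[OF that(4), of k] by (simp add: hi_def)
          next
            case 3
            then show ?thesis using l ii by (auto simp: hamming_lines_def PiE_iff extensional_def)
          qed
        qed
        then show ?thesis using ii by auto
      qed
      have used: "Inl v \<in> p ` ?Lq" if "p l0 = Inl v" "l0 \<in> ?Lq" for v l0
        using that by (metis imageI)
      have used': "Inr j \<in> p ` ?Lq" if "p l0 = Inr j" "l0 \<in> ?Lq" for j l0
        using that by (metis imageI)
      from l(2) have "(i, w) = (i', w')"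
      proof (cases i w rule: P_cases)
        case o: (old v)
        from l(4) show ?thesis
        proof (cases i' w' rule: P_cases)
          case (old v')
          then have "v = v' \<and> hi w = hi w'"
            using o eq by (intro join_inj) auto
          then show ?thesis using o old by (intro fin) auto
        next
          case b: (below j)
          \<comment> \<open>A line of this copy and a line of the copy above would claim the same
            vertex, but \<open>s j\<close> is not a value of \<open>p\<close>.\<close>
          have "v = s j \<and> hi w = g (e (hi w') - 1)"
            using o b eq under[of "hi w'"] by (intro join_inj) auto
          then show ?thesis using b(8) used[OF o(4,2)] by blast
        qed (use o eq in auto)
      next
        case o: (new j)
        from l(4) show ?thesis
        proof (cases i' w' rule: P_cases)
          case (new j')
          \<comment> \<open>Both lines lie in the copy of height 0, hence in the same copy.\<close>
          then show ?thesis using o eq e_inj[of "hi w" "hi w'"] by (intro fin) auto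
        qed (use o eq in auto)
      next
        case o: (below j)
        from l(4) show ?thesis
        proof (cases i' w' rule: P_cases)
          case (old v)
          have "s j = v \<and> g (e (hi w) - 1) = hi w'"
            using o old eq under[of "hi w"] by (intro join_inj) auto
          then show ?thesis using o(8) used[OF old(4,2)] by blast
        next
          case b: (below j')
          have "s j = s j' \<and> g (e (hi w) - 1) = g (e (hi w') - 1)"
            using o b eq under[of "hi w"] under[of "hi w'"] by (intro join_inj) auto
          \<comment> \<open>Both heights are positive in this case, so equal predecessors give equal
            heights and hence equal copies.\<close>
          then have "j = j'" "e (hi w) - 1 = e (hi w') - 1"
            using inj_onD[OF s_inj, of j j'] used'[OF o(4,2)] used'[OF b(4,2)]
              under[of "hi w"] under[of "hi w'"] o(3) b(3) by auto
          then show ?thesis using o b e_inj[of "hi w" "hi w'"] by (intro fin) auto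
        qed (use o eq in auto)
      next
        case o: out
        from l(4) show ?thesis
        proof (cases i' w' rule: P_cases)
          case out
          then show ?thesis using o eq h by (auto simp: bij_betw_def dest: inj_onD)
        qed (use o eq in auto)
      qed
      then show "l = l'" using l by simp
    qed
  qed
  then show thesis by (rule that)
qed

theorem theorem3p1:
  fixes n q :: nat
  assumes "2 \<le> q" and "q \<le> n"
  shows "competition_number (hamming_graph n q)
    \<le> (n - q) * q ^ (n - 1) + competition_number (hamming_graph q q)"
proof -
  obtain D where D: "pair_digraph D" "acyclic (parcs D)"
    "competition_graph D = add_isolated (hamming_graph q q) (competition_number (hamming_graph q q))"
    using competition_number_attained[OF pair_graph_hamming_graph] .
  obtain p r where "prey_assignment q q (competition_number (hamming_graph q q)) p r"
    using prey_assignment_of_digraph[OF assms(1) D] .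
  then obtain P R where
    "prey_assignment n q ((n - q) * q ^ (n - 1) + competition_number (hamming_graph q q)) P R"
    using prey_assignment_lift[OF assms(2)] by blast
  then show ?thesis by (rule competition_number_le_of_prey_assignment)
qed

end
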